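(* Let $A$ be a bounded pseudo-BCK algebra. Define $\Psi:\mathcal{SM}_1(A)\to\mathcal{BS}(A)$ by $\Psi(m)=1-m$. Then $\Psi$ is an affine homeomorphism such that $m$ is a state-measure-morphism if and only if $\Psi(m)$ is a state-morphism. In particular, $m$ is an extremal state-measure if and only if $m$ is a state-measure-morphism.
   Context: A pseudo-BCK algebra is a structure $(A,\le,\rightarrow,\rightsquigarrow,1)$ with $\le$ a binary relation, $\rightarrow,\rightsquigarrow$ binary operations and $1\in A$, such that for all $x,y,z\in A$: $x\rightarrow y\le (y\rightarrow z)\rightsquigarrow(x\rightarrow z)$ and $x\rightsquigarrow y\le (y\rightsquigarrow z)\rightarrow(x\rightsquigarrow z)$; $x\le (x\rightarrow y)\rightsquigarrow y$ and $x\le (x\rightsquigarrow y)\rightarrow y$; $x\le x$; $x\le 1$; antisymmetry of $\le$; $x\le y$ iff $x\rightarrow y=1$ iff $x\rightsquigarrow y=1$. It is bounded if it has a least element $0$. A Bosbach state is a map $s:A\to[0,1]$ with $s(x)+s(x\rightarrow y)=s(y)+s(y\rightarrow x)$, $s(x)+s(x\rightsquigarrow y)=s(y)+s(y\rightsquigarrow x)$, $s(0)=0$, $s(1)=1$; $\mathcal{BS}(A)$ is the set of Bosbach states. A state-morphism is a map $m:A\to[0,1]$ with $m(0)=0$ and $m(x\rightarrow y)=m(x\rightsquigarrow y)=\min\{1-m(x)+m(y),1\}$. A measure is a map $m:A\to[0,\infty)$ with $m(x\rightarrow y)=m(x\rightsquigarrow y)=m(y)-m(x)$ whenever $y\le x$;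 a state-measure is a measure with $m(0)=1$; a state-measure-morphism is a state-measure with $m(x\rightarrow y)=m(x\rightsquigarrow y)=\max\{0,m(y)-m(x)\}$ for all $x,y$. $\mathcal{SM}_1(A)$ denotes the set of state-measures. A state-measure $m$ is extremal if $m=\lambda m_1+(1-\lambda)m_2$ with $0<\lambda<1$ and state-measures $m_1,m_2$ implies $m=m_1=m_2$. Both sets carry the weak topology (pointwise convergence on $A$); "affine" means preserving convex combinations. *)

theory Defs
  imports "HOL-Analysis.Analysis"
begin

text \<open>
  The underlying set of the algebra is the type \<open>'a\<close>, so that maps from the algebra to the
  reals are exactly the elements of \<open>'a \<Rightarrow> real\<close>.
\<close>

locale pseudo_BCK =
  fixes le :: "'a \<Rightarrow> 'a \<Rightarrow> bool" (infix "\<preceq>" 50)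
    and impl :: "'a \<Rightarrow> 'a \<Rightarrow> 'a" (infixr "\<^bold>\<rightarrow>" 60)
    and impr :: "'a \<Rightarrow> 'a \<Rightarrow> 'a" (infixr "\<leadsto>" 60)
    and one :: "'a" ("\<^bold>1")
  assumes impl_trans: "x \<^bold>\<rightarrow> y \<preceq> (y \<^bold>\<rightarrow> z) \<leadsto> (x \<^bold>\<rightarrow> z)"
    and impr_trans: "x \<leadsto> y \<preceq> (y \<leadsto> z) \<^bold>\<rightarrow> (x \<leadsto> z)"
    and le_impl_impr: "x \<preceq> (x \<^bold>\<rightarrow> y) \<leadsto> y"
    and le_impr_impl: "x \<preceq> (x \<leadsto> y) \<^bold>\<rightarrow> y"
    and le_refl: "x \<preceq> x"
    and le_one: "x \<preceq> \<^bold>1"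
    and le_antisym: "x \<preceq> y \<Longrightarrow> y \<preceq> x \<Longrightarrow> x = y"
    and le_iff_impl: "x \<preceq> y \<longleftrightarrow> x \<^bold>\<rightarrow> y = \<^bold>1"
    and le_iff_impr: "x \<preceq> y \<longleftrightarrow> x \<leadsto> y = \<^bold>1"

locale bounded_pseudo_BCK = pseudo_BCK +
  fixes zero :: "'a" ("\<^bold>0")
  assumes zero_le: "\<^bold>0 \<preceq> x"

definition bosbach_state ::
  "('a \<Rightarrow> 'a \<Rightarrow> 'a) \<Rightarrow> ('a \<Rightarrow> 'a \<Rightarrow> 'a) \<Rightarrow> 'a \<Rightarrow> 'a \<Rightarrow> ('a \<Rightarrow> real) \<Rightarrow> bool" where
  "bosbach_state impl impr one zero s \<longleftrightarrow>
     (\<forall>x. s x \<in> {0..1}) \<and>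
     (\<forall>x y. s x + s (impl x y) = s y + s (impl y x)) \<and>
     (\<forall>x y. s x + s (impr x y) = s y + s (impr y x)) \<and>
     s zero = 0 \<and> s one = 1"

definition state_morphism ::
  "('a \<Rightarrow> 'a \<Rightarrow> 'a) \<Rightarrow> ('a \<Rightarrow> 'a \<Rightarrow> 'a) \<Rightarrow> 'a \<Rightarrow> ('a \<Rightarrow> real) \<Rightarrow> bool" where
  "state_morphism impl impr zero m \<longleftrightarrow>
     (\<forall>x. m x \<in> {0..1}) \<and>
     m zero = 0 \<and>
     (\<forall>x y. m (impl x y) = min (1 - m x + m y) 1) \<and>
     (\<forall>x y. m (impr x y) = min (1 - m x + m y) 1)"

definition BCK_measure ::
  "('a \<Rightarrow> 'a \<Rightarrow> bool) \<Rightarrow> ('a \<Rightarrow> 'a \<Rightarrow> 'a) \<Rightarrow> ('a \<Rightarrow> 'a \<Rightarrow> 'a) \<Rightarrow> ('a \<Rightarrow> real) \<Rightarrow> bool" where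
  "BCK_measure le impl impr m \<longleftrightarrow>
     (\<forall>x. m x \<in> {0..}) \<and>
     (\<forall>x y. le y x \<longrightarrow> m (impl x y) = m y - m x) \<and>
     (\<forall>x y. le y x \<longrightarrow> m (impr x y) = m y - m x)"

definition state_measure ::
  "('a \<Rightarrow> 'a \<Rightarrow> bool) \<Rightarrow> ('a \<Rightarrow> 'a \<Rightarrow> 'a) \<Rightarrow> ('a \<Rightarrow> 'a \<Rightarrow> 'a) \<Rightarrow> 'a \<Rightarrow> ('a \<Rightarrow> real) \<Rightarrow> bool" where
  "state_measure le impl impr zero m \<longleftrightarrow> BCK_measure le impl impr m \<and> m zero = 1"

definition state_measure_morphism ::
  "('a \<Rightarrow> 'a \<Rightarrow> bool) \<Rightarrow> ('a \<Rightarrow> 'a \<Rightarrow> 'a) \<Rightarrow> ('a \<Rightarrow> 'a \<Rightarrow> 'a) \<Rightarrow> 'a \<Rightarrow> ('a \<Rightarrow> real) \<Rightarrow> bool" where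
  "state_measure_morphism le impl impr zero m \<longleftrightarrow>
     state_measure le impl impr zero m \<and>
     (\<forall>x y. m (impl x y) = max 0 (m y - m x)) \<and>
     (\<forall>x y. m (impr x y) = max 0 (m y - m x))"

definition SM1 ::
  "('a \<Rightarrow> 'a \<Rightarrow> bool) \<Rightarrow> ('a \<Rightarrow> 'a \<Rightarrow> 'a) \<Rightarrow> ('a \<Rightarrow> 'a \<Rightarrow> 'a) \<Rightarrow> 'a \<Rightarrow> ('a \<Rightarrow> real) set" where
  "SM1 le impl impr zero = {m. state_measure le impl impr zero m}"

definition BS ::
  "('a \<Rightarrow> 'a \<Rightarrow> 'a) \<Rightarrow> ('a \<Rightarrow> 'a \<Rightarrow> 'a) \<Rightarrow> 'a \<Rightarrow> 'a \<Rightarrow> ('a \<Rightarrow> real) set" where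
  "BS impl impr one zero = {s. bosbach_state impl impr one zero s}"

definition convex_comb :: "real \<Rightarrow> ('a \<Rightarrow> real) \<Rightarrow> ('a \<Rightarrow> real) \<Rightarrow> 'a \<Rightarrow> real" where
  "convex_comb t f g = (\<lambda>x. t * f x + (1 - t) * g x)"

definition extremal_state_measure ::
  "('a \<Rightarrow> 'a \<Rightarrow> bool) \<Rightarrow> ('a \<Rightarrow> 'a \<Rightarrow> 'a) \<Rightarrow> ('a \<Rightarrow> 'a \<Rightarrow> 'a) \<Rightarrow> 'a \<Rightarrow> ('a \<Rightarrow> real) \<Rightarrow> bool" where
  "extremal_state_measure le impl impr zero m \<longleftrightarrow>
     m \<in> SM1 le impl impr zero \<and>
     (\<forall>t m1 m2. 0 < t \<and> t < 1 \<and> m1 \<in> SM1 le impl impr zero \<and> m2 \<in> SM1 le impl impr zero \<and>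
        m = convex_comb t m1 m2 \<longrightarrow> m = m1 \<and> m = m2)"

text \<open>
  The domain of an affine map is a convex set, hence the membership clause; it is stated by
  hand because \<open>'a \<Rightarrow> real\<close> is not an instance of \<open>real_vector\<close>.
\<close>

definition affine_on :: "('a \<Rightarrow> real) set \<Rightarrow> (('a \<Rightarrow> real) \<Rightarrow> ('b \<Rightarrow> real)) \<Rightarrow> bool" where
  "affine_on K F \<longleftrightarrow>
     (\<forall>f\<in>K. \<forall>g\<in>K. \<forall>t\<in>{0..1}.
        convex_comb t f g \<in> K \<and> F (convex_comb t f g) = convex_comb t (F f) (F g))"

abbreviation weak_topology_on :: "('a \<Rightarrow> real) set \<Rightarrow> ('a \<Rightarrow> real) topology" where
  "weak_topology_on K \<equiv> subtopology (product_topology (\<lambda>_. euclideanreal) UNIV) K"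

definition Psi :: "('a \<Rightarrow> real) \<Rightarrow> 'a \<Rightarrow> real" where
  "Psi m = (\<lambda>x. 1 - m x)"

end

theory Submission
  imports Defs
begin

text \<open>
  The key identity is \<open>m x + m (x \<rightarrow> y) = m y + m (y \<rightarrow> x)\<close> for every measure \<open>m\<close>: both sides equal
  \<open>m x + m y - m (x \<or> y)\<close>, where the two candidates \<open>(x \<rightarrow> y) \<leadsto> y\<close> and \<open>(y \<rightarrow> x) \<leadsto> x\<close> for a join
  have the same measure. It makes \<open>1 - m\<close> a Bosbach state.

  If \<open>m\<close> is a morphism and \<open>m\<close> is a proper convex combination of \<open>m\<^sub>1\<close> and another state-measure,
  then \<open>m\<^sub>1\<close> vanishes wherever \<open>m\<close> does, hence \<open>m x \<le> m y\<close> implies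
  \<open>m\<^sub>1 (x \<rightarrow> y) = m\<^sub>1 y - m\<^sub>1 x\<close>. The deviation \<open>m\<^sub>1 - m\<close> is therefore doubled in absolute value
  by passing from \<open>x\<close> to an element of measure \<open>\<bar>1 - 2 m x\<bar>\<close>; being bounded, it is zero.

  Conversely, let \<open>m\<close> be extremal. For each \<open>h\<close>, the limit \<open>L g\<close> of \<open>m (h \<rightarrow> (h \<rightarrow> \<dots> (h \<rightarrow> g)))\<close>
  is a measure such that \<open>m - L\<close> is a measure too (reading the algebra with reversed order inside
  a lattice-ordered group, \<open>m - L\<close> is the component \<open>sup\<^sub>n m (g \<and> n h)\<close>), so \<open>L = c m\<close> for some constant \<open>c\<close>.
  If \<open>f\<close> and \<open>g\<close> are disjoint, then for \<open>h = f\<close> one has \<open>L f = 0\<close> and \<open>L g = m g\<close>, whence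
  \<open>m f = 0\<close> or \<open>m g = 0\<close>. Applied to disjoint \<open>f\<close>, \<open>g\<close> with the measures of \<open>x \<rightarrow> y\<close> and \<open>y \<rightarrow> x\<close>,
  this shows that \<open>m\<close> is a morphism.
\<close>

section \<open>Pseudo-BCK algebras\<close>

text \<open>The axioms are symmetric in the two arrows, so each later fact has a
  \<open>dual.\<close> version with them exchanged.\<close>

sublocale pseudo_BCK \<subseteq> dual: pseudo_BCK le impr impl one
  by unfold_locales
    (fact impr_trans impl_trans le_impr_impl le_impl_impr le_refl le_one
       le_iff_impr le_iff_impl | erule (1) le_antisym)+

lemma (in pseudo_BCK) one_le_iff: "\<^bold>1 \<preceq> x \<longleftrightarrow> x = \<^bold>1"
  using le_one le_antisym le_refl by blast

lemma (in pseudo_BCK) impl_antimono: "x \<preceq> y \<Longrightarrow> y \<^bold>\<rightarrow> z \<preceq> x \<^bold>\<rightarrow> z"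
  using impl_trans[of x y z] le_iff_impl[of x y] one_le_iff le_iff_impr by metis

lemma (in pseudo_BCK) le_trans: "x \<preceq> y \<Longrightarrow> y \<preceq> z \<Longrightarrow> x \<preceq> z"
  using impl_antimono[of x y z] le_iff_impl one_le_iff by metis

lemma (in pseudo_BCK) galois: "x \<preceq> y \<^bold>\<rightarrow> z \<longleftrightarrow> y \<preceq> x \<leadsto> z"
proof
  show "y \<preceq> x \<leadsto> z" if "x \<preceq> y \<^bold>\<rightarrow> z"
    using le_trans[OF le_impl_impr dual.impl_antimono[OF that]] .
  show "x \<preceq> y \<^bold>\<rightarrow> z" if "y \<preceq> x \<leadsto> z"
    using le_trans[OF le_impr_impl impl_antimono[OF that]] .
qed

lemma (in pseudo_BCK) le_impl: "y \<preceq> x \<^bold>\<rightarrow> y"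
  using galois le_iff_impr le_one le_refl by metis

lemma (in pseudo_BCK) impl_prefixing: "y \<^bold>\<rightarrow> z \<preceq> (x \<^bold>\<rightarrow> y) \<^bold>\<rightarrow> (x \<^bold>\<rightarrow> z)"
  using impl_trans galois by blast

lemma (in pseudo_BCK) impl_exchange: "x \<^bold>\<rightarrow> (y \<leadsto> z) = y \<leadsto> (x \<^bold>\<rightarrow> z)"
proof (rule le_antisym)
  have "y \<preceq> (x \<^bold>\<rightarrow> (y \<leadsto> z)) \<^bold>\<rightarrow> (x \<^bold>\<rightarrow> z)"
    using le_trans[OF le_impr_impl impl_prefixing] .
  then show "x \<^bold>\<rightarrow> (y \<leadsto> z) \<preceq> y \<leadsto> (x \<^bold>\<rightarrow> z)"
    by (simp add: galois)
  have "x \<preceq> (y \<leadsto> (x \<^bold>\<rightarrow> z)) \<leadsto> (y \<leadsto> z)"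
    using le_trans[OF le_impl_impr dual.impl_prefixing] .
  then show "y \<leadsto> (x \<^bold>\<rightarrow> z) \<preceq> x \<^bold>\<rightarrow> (y \<leadsto> z)"
    by (simp add: galois)
qed

lemma (in pseudo_BCK) funpow_impl_exchange: "(impl h ^^ n) (x \<leadsto> y) = x \<leadsto> (impl h ^^ n) y"
  by (induction n) (simp_all add: impl_exchange)

lemma (in pseudo_BCK) le_funpow_impl: "x \<preceq> (impl h ^^ n) x"
  by (induction n) (auto intro: le_refl le_trans le_impl)

lemma (in pseudo_BCK) impl_mono: "y \<preceq> z \<Longrightarrow> x \<^bold>\<rightarrow> y \<preceq> x \<^bold>\<rightarrow> z"
  using impl_prefixing le_iff_impl one_le_iff by metis

lemma (in pseudo_BCK) funpow_impl_mono: "x \<preceq> y \<Longrightarrow> (impl h ^^ n) x \<preceq> (impl h ^^ n) y"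
  by (induction n) (auto intro: impl_mono)

lemma (in pseudo_BCK) le_funpow_impl_impl: "x \<^bold>\<rightarrow> y \<preceq> (impl h ^^ n) x \<^bold>\<rightarrow> (impl h ^^ n) y"
  by (induction n) (auto intro: le_refl le_trans impl_prefixing)

section \<open>Measures\<close>

locale measured_pseudo_BCK = pseudo_BCK +
  fixes m :: "'a \<Rightarrow> real"
  assumes nonneg: "0 \<le> m x"
    and impl_diff: "y \<preceq> x \<Longrightarrow> m (x \<^bold>\<rightarrow> y) = m y - m x"
    and impr_diff: "y \<preceq> x \<Longrightarrow> m (x \<leadsto> y) = m y - m x"

sublocale measured_pseudo_BCK \<subseteq> dual: measured_pseudo_BCK le impr impl one m
  by unfold_locales (simp_all add: nonneg impl_diff impr_diff)

lemma (in measured_pseudo_BCK) measure_one: "m \<^bold>1 = 0"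
  using impl_diff[OF le_refl] le_iff_impl le_refl by force

lemma (in measured_pseudo_BCK) antimono: "x \<preceq> y \<Longrightarrow> m y \<le> m x"
  using impl_diff[of x y] nonneg[of "y \<^bold>\<rightarrow> x"] by simp

lemma (in measured_pseudo_BCK) measure_impl: "m (x \<^bold>\<rightarrow> y) = m y - m ((x \<^bold>\<rightarrow> y) \<leadsto> y)"
  using impr_diff[OF le_impl[of y x]] by simp

text \<open>The candidate join lies below \<open>(t \<rightarrow> y) \<leadsto> y\<close>, which has
  the measure of \<open>t\<close> because \<open>y\<close> is below \<open>t\<close>.\<close>

lemma (in measured_pseudo_BCK) measure_join_le:
  "x \<preceq> t \<Longrightarrow> y \<preceq> t \<Longrightarrow> m t \<le> m ((x \<^bold>\<rightarrow> y) \<leadsto> y)"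
  using antimono[OF dual.impl_antimono[OF impl_antimono], of x t y]
    measure_impl[of t y] impl_diff[of y t] by simp

lemma (in measured_pseudo_BCK) measure_join_commute:
  "m ((x \<^bold>\<rightarrow> y) \<leadsto> y) = m ((y \<^bold>\<rightarrow> x) \<leadsto> x)"
  by (intro order_antisym measure_join_le le_impl_impr dual.le_impl)

lemma (in measured_pseudo_BCK) measure_impl_eq_impr: "m (x \<^bold>\<rightarrow> y) = m (x \<leadsto> y)"
proof -
  have "m ((x \<^bold>\<rightarrow> y) \<leadsto> y) = m ((x \<leadsto> y) \<^bold>\<rightarrow> y)"
    by (intro order_antisym measure_join_le dual.measure_join_le le_impl_impr
        dual.le_impl le_impr_impl le_impl)
  then show ?thesis
    using measure_impl[of x y] dual.measure_impl[of x y] by simp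
qed

lemma (in measured_pseudo_BCK) bosbach: "m x + m (x \<^bold>\<rightarrow> y) = m y + m (y \<^bold>\<rightarrow> x)"
  using measure_impl[of x y] measure_impl[of y x] measure_join_commute[of x y] by simp

lemma (in measured_pseudo_BCK) measure_le_add_impl: "m y \<le> m x + m (x \<^bold>\<rightarrow> y)"
  using bosbach[of x y] nonneg[of "y \<^bold>\<rightarrow> x"] by simp

lemma (in measured_pseudo_BCK) measure_impl_triangle:
  "m (x \<^bold>\<rightarrow> z) \<le> m (x \<^bold>\<rightarrow> y) + m (y \<^bold>\<rightarrow> z)"
  using measure_le_add_impl[of "x \<^bold>\<rightarrow> z" "x \<^bold>\<rightarrow> y"] antimono[OF impl_prefixing[of y z x]]
  by simp

text \<open>In \<open>h \<rightarrow> \<dots> (h \<rightarrow> w)\<close> the outermost arrow can be replaced by \<open>\<leadsto>\<close> and then moved inside by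
  the exchange law.\<close>
lemma (in measured_pseudo_BCK) measure_funpow_eq:
  "m ((impl h ^^ n) w) = m ((impr h ^^ n) w)"
proof (induction n arbitrary: w)
  case (Suc n)
  have "m ((impl h ^^ Suc n) w) = m ((impl h ^^ n) (h \<leadsto> w))"
    by (simp add: measure_impl_eq_impr funpow_impl_exchange)
  also have "\<dots> = m ((impr h ^^ Suc n) w)"
    by (simp add: Suc funpow_swap1)
  finally show ?case .
qed simp

section \<open>Iterated implications and their limit measure\<close>

lemma (in measured_pseudo_BCK) funpow_superadditive:
  assumes "y \<preceq> x"
  shows "m ((impl h ^^ n) x) + m ((impl h ^^ n) (x \<leadsto> y)) \<le> m ((impl h ^^ n) y)"
  using antimono[OF dual.impl_antimono[OF le_funpow_impl[of x n h], of "(impl h ^^ n) y"]]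
    impr_diff[OF funpow_impl_mono[OF assms, of n h]] funpow_impl_exchange[of n h x y]
  by simp

lemma (in measured_pseudo_BCK) funpow_subadditive:
  "m ((impl h ^^ (n + n)) y) \<le> m ((impl h ^^ n) x) + m ((impl h ^^ n) (x \<^bold>\<rightarrow> y))"
proof -
  let ?T = "impl h ^^ n" and ?T' = "impr h ^^ n"
  \<comment> \<open>Trading the outer \<open>?T\<close> for \<open>?T'\<close> lets it move past
    \<open>\<rightarrow>\<close>. The doubled exponent is harmless in the limit.\<close>
  have "m (?T (?T y)) \<le> m (?T x) + m (?T x \<^bold>\<rightarrow> ?T' (?T y))"
    using measure_le_add_impl measure_funpow_eq by metis
  also have "?T x \<^bold>\<rightarrow> ?T' (?T y) = ?T' (?T x \<^bold>\<rightarrow> ?T y)"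
    by (simp add: dual.funpow_impl_exchange)
  also have "m \<dots> \<le> m (?T' (x \<^bold>\<rightarrow> y))"
    by (intro antimono dual.funpow_impl_mono le_funpow_impl_impl)
  finally show ?thesis
    by (simp add: funpow_add measure_funpow_eq)
qed

text \<open>This is the limit \<open>L\<close> of the overview; it exists because the sequence
  decreases and is bounded below by 0.\<close>

definition (in measured_pseudo_BCK) residual :: "'a \<Rightarrow> 'a \<Rightarrow> real" where
  "residual h g = lim (\<lambda>n. m ((impl h ^^ n) g))"

lemma (in measured_pseudo_BCK) residual_tendsto:
  "(\<lambda>n. m ((impl h ^^ n) g)) \<longlonglongrightarrow> residual h g"
proof -
  have "decseq (\<lambda>n. m ((impl h ^^ n) g))"
    by (intro decseq_SucI) (simp add: antimono le_impl)
  then have "convergent (\<lambda>n. m ((impl h ^^ n) g))"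
    using decseq_convergent[of _ 0] nonneg convergentI by metis
  then show ?thesis
    by (simp add: residual_def convergent_LIMSEQ_iff)
qed

lemma (in measured_pseudo_BCK) residual_eq_dual: "dual.residual = residual"
  unfolding residual_def dual.residual_def by (simp add: measure_funpow_eq)

lemma (in measured_pseudo_BCK) residual_nonneg: "0 \<le> residual h g"
  by (rule LIMSEQ_le_const[OF residual_tendsto]) (auto simp: nonneg)

lemma (in measured_pseudo_BCK) residual_le: "residual h g \<le> m g"
  by (rule LIMSEQ_le_const2[OF residual_tendsto]) (auto intro: antimono le_funpow_impl)

lemma (in measured_pseudo_BCK) residual_superadditive:
  assumes "y \<preceq> x"
  shows "residual h x + residual h (x \<leadsto> y) \<le> residual h y"
  by (rule LIMSEQ_le[OF tendsto_add[OF residual_tendsto residual_tendsto] residual_tendsto])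
    (auto intro: funpow_superadditive assms)

lemma (in measured_pseudo_BCK) residual_subadditive:
  "residual h y \<le> residual h x + residual h (x \<^bold>\<rightarrow> y)"
proof (rule LIMSEQ_le[OF _ tendsto_add[OF residual_tendsto residual_tendsto]])
  have "strict_mono (\<lambda>n::nat. n + n)"
    by (auto simp: strict_mono_def)
  from LIMSEQ_subseq_LIMSEQ[OF residual_tendsto this]
  show "(\<lambda>n. m ((impl h ^^ (n + n)) y)) \<longlonglongrightarrow> residual h y"
    by (simp add: o_def)
qed (auto intro: funpow_subadditive)

lemma (in measured_pseudo_BCK) residual_impl_diff:
  "y \<preceq> x \<Longrightarrow> residual h (x \<^bold>\<rightarrow> y) = residual h y - residual h x"
  using dual.residual_superadditive[of y x h] residual_subadditive[of h y x]
  by (simp add: residual_eq_dual)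

lemma (in measured_pseudo_BCK) residual_impr_diff:
  "y \<preceq> x \<Longrightarrow> residual h (x \<leadsto> y) = residual h y - residual h x"
  using dual.residual_impl_diff[of y x h] by (simp add: residual_eq_dual)

lemma (in measured_pseudo_BCK) residual_self: "residual h h = 0"
proof -
  have "(impl h ^^ Suc n) h = \<^bold>1" for n
    using le_funpow_impl[of h n h] le_iff_impl by simp
  then have "(\<lambda>n. m ((impl h ^^ Suc n) h)) \<longlonglongrightarrow> 0"
    by (simp add: measure_one)
  then show ?thesis
    using LIMSEQ_Suc[OF residual_tendsto] LIMSEQ_unique by blast
qed

text \<open>The hypothesis expresses disjointness of \<open>h\<close> and \<open>g\<close>. It
  survives each iteration, since an iterate of unchanged measure differs from \<open>g\<close> by a
  null element.\<close>

lemma (in measured_pseudo_BCK) residual_eq_if_disjoint: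
  assumes "m g \<le> m (h \<^bold>\<rightarrow> g)"
  shows "residual h g = m g"
proof -
  have "m ((impl h ^^ n) g) = m g" for n
  proof (induction n)
    case (Suc n)
    let ?w = "(impl h ^^ n) g"
    have "m (?w \<^bold>\<rightarrow> g) = 0"
      using impl_diff[OF le_funpow_impl[of g n h]] Suc by simp
    then have "m g \<le> m (h \<^bold>\<rightarrow> ?w)"
      using measure_impl_triangle[of h g ?w] assms by simp
    then show ?case
      using antimono[OF le_impl[of ?w h]] Suc by simp
  qed simp
  then show ?thesis
    using residual_tendsto[of h g] by (simp add: LIMSEQ_const_iff)
qed

section \<open>State-measures\<close>

context bounded_pseudo_BCK
begin

lemma BCK_measure_iff: "BCK_measure le impl impr m \<longleftrightarrow> measured_pseudo_BCK le impl impr one m"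
  unfolding BCK_measure_def measured_pseudo_BCK_def measured_pseudo_BCK_axioms_def
  using pseudo_BCK_axioms by auto

abbreviation sm :: "('a \<Rightarrow> real) \<Rightarrow> bool" where
  "sm \<equiv> state_measure le impl impr zero"

section \<open>State-measures and Bosbach states\<close>

lemma Psi_bosbach_state:
  assumes "sm m"
  shows "bosbach_state impl impr one zero (Psi m)"
proof -
  interpret measured_pseudo_BCK le impl impr one m
    using assms by (simp add: state_measure_def BCK_measure_iff)
  have m0: "m \<^bold>0 = 1"
    using assms by (simp add: state_measure_def)
  have "m x \<le> 1" for x
    using antimono[OF zero_le[of x]] m0 by simp
  then show ?thesis
    unfolding bosbach_state_def Psi_def
    using nonneg m0 measure_one bosbach dual.bosbach by (simp add: algebra_simps)
qed

lemma Psi_state_measure: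
  assumes "bosbach_state impl impr one zero s"
  shows "sm (Psi s)"
proof -
  have s: "s x \<le> 1" "s x + s (impl x y) = s y + s (impl y x)"
    "s x + s (impr x y) = s y + s (impr y x)" "s \<^bold>0 = 0" "s \<^bold>1 = 1" for x y
    using assms by (auto simp: bosbach_state_def)
  have "s (impl x y) = 1 + s y - s x" "s (impr x y) = 1 + s y - s x" if "y \<preceq> x" for x y
    using that s(2,3)[of x y] s(5) le_iff_impl[of y x] le_iff_impr[of y x] by auto
  then show ?thesis
    unfolding state_measure_def BCK_measure_def Psi_def using s by auto
qed

lemma state_measure_convex_comb:
  assumes "sm f" "sm g" "t \<in> {0..1}"
  shows "sm (convex_comb t f g)"
  using assms unfolding state_measure_def BCK_measure_def convex_comb_def
  by auto (simp_all add: algebra_simps)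

section \<open>Morphisms are extremal\<close>

lemma state_measure_morphism_extremal:
  assumes m: "state_measure_morphism le impl impr zero m"
    and "sm m1" "sm m2" "0 < t" "t < 1" and comb: "m = convex_comb t m1 m2"
  shows "m1 = m"
proof -
  have mi: "m (x \<^bold>\<rightarrow> y) = max 0 (m y - m x)" and m0: "m \<^bold>0 = 1" for x y
    using m by (auto simp: state_measure_morphism_def state_measure_def)
  interpret m: measured_pseudo_BCK le impl impr one m
    using m by (simp add: state_measure_morphism_def state_measure_def BCK_measure_iff)
  interpret m1: measured_pseudo_BCK le impl impr one m1
    using assms by (simp add: state_measure_def BCK_measure_iff)
  interpret m2: measured_pseudo_BCK le impl impr one m2
    using assms by (simp add: state_measure_def BCK_measure_iff)
  have m10: "m1 \<^bold>0 = 1"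
    using assms by (simp add: state_measure_def)
  have le1: "m x \<le> 1" "m1 x \<le> 1" for x
    using m.antimono[OF zero_le[of x]] m1.antimono[OF zero_le[of x]] m0 m10 by auto
  have null: "m1 x = 0" if "m x = 0" for x
  proof -
    have "t * m1 x + (1 - t) * m2 x = 0"
      using that comb by (simp add: convex_comb_def)
    moreover have "0 \<le> t * m1 x" "0 \<le> (1 - t) * m2 x"
      using \<open>0 < t\<close> \<open>t < 1\<close> m1.nonneg m2.nonneg by auto
    ultimately have "t * m1 x = 0"
      by linarith
    with \<open>0 < t\<close> show ?thesis
      by simp
  qed
  have m1i: "m1 (x \<^bold>\<rightarrow> y) = m1 y - m1 x" if "m x \<le> m y" for x y
    using null[of "y \<^bold>\<rightarrow> x"] that mi[of y x] m1.bosbach[of x y] by simp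
  have neg: "m (x \<^bold>\<rightarrow> \<^bold>0) = 1 - m x" "m1 (x \<^bold>\<rightarrow> \<^bold>0) = 1 - m1 x" for x
    using m.impl_diff[OF zero_le[of x]] m1.impl_diff[OF zero_le[of x]] m0 m10 by auto
  have dev: "\<bar>m1 x - m x\<bar> \<le> 1 / 2 ^ n" for n x
  proof (induction n arbitrary: x)
    case 0
    then show ?case
      using le1[of x] m.nonneg[of x] m1.nonneg[of x] by (simp add: abs_le_iff)
  next
    case (Suc n)
    \<comment> \<open>Here the deviation doubles at
      \<open>x \<rightarrow> x \<rightarrow> 0\<close>, where both measures are affine in their
      value at \<open>x\<close>.\<close>
    have half: "\<bar>m1 x - m x\<bar> \<le> 1 / 2 ^ Suc n" if "m x \<le> 1 / 2" for x
    proof -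
      have "m x \<le> m (x \<^bold>\<rightarrow> \<^bold>0)"
        using that by (simp add: neg)
      then have "m1 (x \<^bold>\<rightarrow> x \<^bold>\<rightarrow> \<^bold>0) = 1 - 2 * m1 x" "m (x \<^bold>\<rightarrow> x \<^bold>\<rightarrow> \<^bold>0) = 1 - 2 * m x"
        using m1i[of x "x \<^bold>\<rightarrow> \<^bold>0"] mi[of x "x \<^bold>\<rightarrow> \<^bold>0"] neg[of x] by auto
      then have "2 * \<bar>m1 x - m x\<bar> \<le> 1 / 2 ^ n"
        using Suc[of "x \<^bold>\<rightarrow> x \<^bold>\<rightarrow> \<^bold>0"] by (simp add: abs_if split: if_splits)
      then show ?thesis
        by simp
    qed
    show ?case
    proof (cases "m x \<le> 1 / 2")
      \<comment> \<open>Negation reflects \<open>m x\<close> into the lower half and keeps the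
        absolute deviation.\<close>
      case False
      then have "\<bar>m1 (x \<^bold>\<rightarrow> \<^bold>0) - m (x \<^bold>\<rightarrow> \<^bold>0)\<bar> \<le> 1 / 2 ^ Suc n"
        by (intro half) (simp add: neg)
      then show ?thesis
        by (simp add: neg abs_minus_commute)
    qed (rule half)
  qed
  have "m1 x = m x" for x
  proof -
    have "(\<lambda>n. (1 / 2 :: real) ^ n) \<longlonglongrightarrow> 0"
      by (rule LIMSEQ_power_zero) simp
    then have "\<bar>m1 x - m x\<bar> \<le> 0"
      using dev by (intro LIMSEQ_le_const) (auto simp: power_divide)
    then show ?thesis
      by simp
  qed
  then show ?thesis
    by auto
qed

section \<open>Extremal state-measures are morphisms\<close>

text \<open>Scaling a nonzero measure to a state-measure.\<close>
lemma BCK_measure_normalize: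
  assumes "BCK_measure le impl impr \<mu>" "\<mu> \<^bold>0 \<noteq> 0"
  shows "sm (\<lambda>x. \<mu> x / \<mu> \<^bold>0)"
  using assms unfolding BCK_measure_def state_measure_def by (auto simp: diff_divide_distrib)

lemma BCK_measure_eq_zero:
  assumes "BCK_measure le impl impr \<mu>" "\<mu> \<^bold>0 = 0"
  shows "\<mu> x = 0"
proof -
  interpret measured_pseudo_BCK le impl impr one \<mu>
    using assms by (simp add: BCK_measure_iff)
  show ?thesis
    using antimono[OF zero_le[of x]] nonneg[of x] assms by simp
qed

text \<open>Normalizing both summands makes \<open>m\<close> a convex combination with weight
  \<open>\<mu> 0\<close>. A summand that is zero at \<open>0\<close> vanishes everywhere and is
  treated separately.\<close>

lemma extremal_proportional:
  assumes ext: "extremal_state_measure le impl impr zero m"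
    and mu: "BCK_measure le impl impr \<mu>" and nu: "BCK_measure le impl impr \<nu>"
    and sum: "\<And>x. m x = \<mu> x + \<nu> x"
  shows "\<mu> x = \<mu> \<^bold>0 * m x"
proof -
  have "m \<^bold>0 = 1"
    using ext by (simp add: extremal_state_measure_def SM1_def state_measure_def)
  then have s: "\<nu> \<^bold>0 = 1 - \<mu> \<^bold>0"
    using sum[of "\<^bold>0"] by simp
  consider "\<mu> \<^bold>0 = 0" | "\<nu> \<^bold>0 = 0" | "\<mu> \<^bold>0 \<noteq> 0" "\<nu> \<^bold>0 \<noteq> 0"
    by blast
  then show ?thesis
  proof cases
    case 1
    then show ?thesis
      using BCK_measure_eq_zero[OF mu] by simp
  next
    case 2
    then show ?thesis
      using BCK_measure_eq_zero[OF nu] s sum by simp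
  next
    case 3
    have "0 \<le> \<mu> \<^bold>0" "0 \<le> \<nu> \<^bold>0"
      using mu nu by (auto simp: BCK_measure_def)
    with 3 s have t: "0 < \<mu> \<^bold>0" "\<mu> \<^bold>0 < 1"
      by auto
    have "m = convex_comb (\<mu> \<^bold>0) (\<lambda>x. \<mu> x / \<mu> \<^bold>0) (\<lambda>x. \<nu> x / \<nu> \<^bold>0)"
      using 3 s sum by (auto simp: convex_comb_def)
    then have "m = (\<lambda>x. \<mu> x / \<mu> \<^bold>0)"
      using ext t BCK_measure_normalize[OF mu 3(1)] BCK_measure_normalize[OF nu 3(2)]
      unfolding extremal_state_measure_def SM1_def mem_Collect_eq by blast
    then have "m x = \<mu> x / \<mu> \<^bold>0"
      by (rule fun_cong)
    then show ?thesis
      using 3 by simp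
  qed
qed

lemma extremal_morphism:
  assumes ext: "extremal_state_measure le impl impr zero m"
  shows "state_measure_morphism le impl impr zero m"
proof -
  have sm: "sm m"
    using ext by (simp add: extremal_state_measure_def SM1_def)
  then have m0: "m \<^bold>0 = 1"
    by (simp add: state_measure_def)
  interpret measured_pseudo_BCK le impl impr one m
    using sm by (simp add: state_measure_def BCK_measure_iff)
  have proportional: "residual h x = residual h \<^bold>0 * m x" for h x
  proof (rule extremal_proportional[OF ext])
    show "BCK_measure le impl impr (residual h)"
      by (simp add: BCK_measure_def residual_nonneg residual_impl_diff residual_impr_diff)
    show "BCK_measure le impl impr (\<lambda>x. m x - residual h x)"
      by (simp add: BCK_measure_def residual_le residual_impl_diff residual_impr_diff
          impl_diff impr_diff)
  qed simp
  \<comment> \<open>With \<open>h = f\<close>, the proportionality constant is 0 unless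
    \<open>m f = 0\<close>; if it is 0, then \<open>m g\<close> vanishes.\<close>
  have disj: "m f = 0 \<or> m g = 0" if "m g \<le> m (f \<^bold>\<rightarrow> g)" for f g
    using proportional[of f f] proportional[of f g] residual_self
      residual_eq_if_disjoint[OF that] by auto
  have neg: "m (x \<^bold>\<rightarrow> \<^bold>0) = 1 - m x" "m (x \<leadsto> \<^bold>0) = 1 - m x" for x
    using impl_diff[OF zero_le] impr_diff[OF zero_le] m0 by auto
  have main: "m (x \<^bold>\<rightarrow> y) = 0 \<or> m (y \<^bold>\<rightarrow> x) = 0" for x y
  proof -
    text \<open>Up to null elements, \<open>c\<close> is the meet of \<open>x\<close> and \<open>y\<close>, obtained from the join \<open>v\<close> of the
      negations; then \<open>x \<leadsto> c\<close> and \<open>y \<leadsto> c\<close> are the disjoint pair.\<close>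
    define v where "v = ((x \<^bold>\<rightarrow> \<^bold>0) \<^bold>\<rightarrow> (y \<^bold>\<rightarrow> \<^bold>0)) \<leadsto> (y \<^bold>\<rightarrow> \<^bold>0)"
    define c where "c = v \<leadsto> \<^bold>0"
    have dneg: "m (((z \<^bold>\<rightarrow> \<^bold>0) \<leadsto> \<^bold>0) \<^bold>\<rightarrow> z) = 0" for z
      using impl_diff[OF le_impl_impr[of z "\<^bold>0"]] by (simp add: neg)
    have null: "m (c \<^bold>\<rightarrow> z) = 0" if "z \<^bold>\<rightarrow> \<^bold>0 \<preceq> v" for z
    proof -
      have "m (c \<^bold>\<rightarrow> z) \<le> m (((z \<^bold>\<rightarrow> \<^bold>0) \<leadsto> \<^bold>0) \<^bold>\<rightarrow> z)"
        unfolding c_def by (intro antimono impl_antimono dual.impl_antimono that)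
      then show ?thesis
        using dneg nonneg[of "c \<^bold>\<rightarrow> z"] by simp
    qed
    have cx: "m (c \<^bold>\<rightarrow> x) = 0" and cy: "m (c \<^bold>\<rightarrow> y) = 0"
      by (auto intro!: null simp: v_def le_impl_impr dual.le_impl)
    \<comment> \<open>Exchange turns the contrapositive into a double negation, which
      \<open>dneg\<close> removes up to null elements.\<close>
    have "m ((x \<^bold>\<rightarrow> \<^bold>0) \<^bold>\<rightarrow> (y \<^bold>\<rightarrow> \<^bold>0)) = m (y \<^bold>\<rightarrow> (x \<^bold>\<rightarrow> \<^bold>0) \<leadsto> \<^bold>0)"
      by (simp add: measure_impl_eq_impr impl_exchange)
    also have "\<dots> = m (y \<^bold>\<rightarrow> x)"
    proof (rule order_antisym)
      show "m (y \<^bold>\<rightarrow> (x \<^bold>\<rightarrow> \<^bold>0) \<leadsto> \<^bold>0) \<le> m (y \<^bold>\<rightarrow> x)"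
        by (intro antimono impl_mono le_impl_impr)
      show "m (y \<^bold>\<rightarrow> x) \<le> m (y \<^bold>\<rightarrow> (x \<^bold>\<rightarrow> \<^bold>0) \<leadsto> \<^bold>0)"
        using measure_impl_triangle[of y x "(x \<^bold>\<rightarrow> \<^bold>0) \<leadsto> \<^bold>0"] dneg[of x] by simp
    qed
    finally have "m v = 1 - m y - m (y \<^bold>\<rightarrow> x)"
      using measure_impl[of "x \<^bold>\<rightarrow> \<^bold>0" "y \<^bold>\<rightarrow> \<^bold>0"] by (simp add: v_def neg)
    then have c: "m c = m y + m (y \<^bold>\<rightarrow> x)"
      by (simp add: c_def neg)
    have xc: "m (x \<leadsto> c) = m (x \<^bold>\<rightarrow> y)" and yc: "m (y \<leadsto> c) = m (y \<^bold>\<rightarrow> x)"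
      using bosbach[of x c] bosbach[of y c] cx cy c bosbach[of x y]
      by (auto simp: measure_impl_eq_impr)
    \<comment> \<open>The join \<open>?j\<close> of \<open>x\<close> and \<open>c\<close> differs
      from \<open>x\<close> by a null element. Substituting it in \<open>y \<rightarrow> x\<close>
      and exchanging yields the disjointness required by \<open>disj\<close>.\<close>
    let ?j = "(x \<leadsto> c) \<^bold>\<rightarrow> c"
    have "m ?j = m x"
      using dual.measure_impl[of x c] xc c bosbach[of x y] by simp
    then have "m (?j \<^bold>\<rightarrow> x) = 0"
      using impl_diff[OF le_impr_impl[of x c]] by simp
    then have "m (y \<^bold>\<rightarrow> x) \<le> m (y \<^bold>\<rightarrow> ?j)"
      using measure_impl_triangle[of y x ?j] by simp
    also have "\<dots> = m ((x \<leadsto> c) \<^bold>\<rightarrow> (y \<leadsto> c))"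
      by (simp add: measure_impl_eq_impr[of y] impl_exchange)
    finally show ?thesis
      using disj[of "y \<leadsto> c" "x \<leadsto> c"] xc yc by simp
  qed
  have "m (x \<^bold>\<rightarrow> y) = max 0 (m y - m x)" for x y
    using main[of x y] bosbach[of x y] nonneg[of "x \<^bold>\<rightarrow> y"] nonneg[of "y \<^bold>\<rightarrow> x"] by auto
  then show ?thesis
    unfolding state_measure_morphism_def using sm measure_impl_eq_impr by auto
qed

lemma extremal_iff_morphism:
  "extremal_state_measure le impl impr zero m \<longleftrightarrow> state_measure_morphism le impl impr zero m"
proof
  assume m: "state_measure_morphism le impl impr zero m"
  show "extremal_state_measure le impl impr zero m"
    unfolding extremal_state_measure_def
  proof (intro conjI allI impI; (elim conjE)?)
    show "m \<in> SM1 le impl impr zero"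
      using m by (simp add: state_measure_morphism_def SM1_def)
    fix t :: real and m1 m2
    assume t: "0 < t" "t < 1" and sm: "m1 \<in> SM1 le impl impr zero" "m2 \<in> SM1 le impl impr zero"
      and comb: "m = convex_comb t m1 m2"
    show "m = m1"
      using state_measure_morphism_extremal[OF m _ _ t comb] sm by (simp add: SM1_def)
    have "m = convex_comb (1 - t) m2 m1"
      using comb by (simp add: convex_comb_def algebra_simps)
    then show "m = m2"
      using state_measure_morphism_extremal[OF m, of m2 m1 "1 - t"] t sm by (simp add: SM1_def)
  qed
qed (rule extremal_morphism)

section \<open>Properties of the map \<open>Psi\<close>\<close>

lemma morphism_iff_Psi:
  assumes "sm m"
  shows "state_measure_morphism le impl impr zero m \<longleftrightarrow> state_morphism impl impr zero (Psi m)"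
proof -
  have "1 - a = min (1 - (1 - b) + (1 - c)) 1 \<longleftrightarrow> a = max 0 (c - b)" for a b c :: real
    by (auto simp: min_def max_def)
  moreover have "Psi m x \<in> {0..1}" "Psi m \<^bold>0 = 0" for x
    using Psi_bosbach_state[OF assms] by (auto simp: bosbach_state_def)
  ultimately show ?thesis
    using assms by (simp add: state_measure_morphism_def state_morphism_def Psi_def)
qed

lemma continuous_map_Psi:
  "continuous_map (weak_topology_on K)
     (product_topology (\<lambda>_. euclideanreal) UNIV) Psi"
  unfolding continuous_map_componentwise_UNIV Psi_def
  by (intro allI continuous_map_diff continuous_map_from_subtopology
      continuous_map_product_projection) auto

text \<open>\<open>Psi\<close> is an involution, so one continuity statement serves both
  directions.\<close>

lemma homeomorphic_map_Psi:
  "homeomorphic_map (weak_topology_on (SM1 le impl impr zero))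
     (weak_topology_on (BS impl impr one zero)) Psi"
  unfolding homeomorphic_map_maps homeomorphic_maps_def continuous_map_in_subtopology
proof (intro exI[of _ Psi] conjI continuous_map_Psi)
qed (auto simp: SM1_def BS_def Psi_bosbach_state Psi_state_measure, auto simp: Psi_def)

end

theorem theorem4p7:
  fixes le :: "'a \<Rightarrow> 'a \<Rightarrow> bool"
    and impl impr :: "'a \<Rightarrow> 'a \<Rightarrow> 'a"
    and one zero :: 'a
  assumes "bounded_pseudo_BCK le impl impr one zero"
  shows "homeomorphic_map (weak_topology_on (SM1 le impl impr zero))
           (weak_topology_on (BS impl impr one zero)) Psi
       \<and> affine_on (SM1 le impl impr zero) Psi
       \<and> (\<forall>m\<in>SM1 le impl impr zero.
            state_measure_morphism le impl impr zero m \<longleftrightarrow> state_morphism impl impr zero (Psi m))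
       \<and> (\<forall>m\<in>SM1 le impl impr zero.
            extremal_state_measure le impl impr zero m \<longleftrightarrow>
            state_measure_morphism le impl impr zero m)"
proof -
  interpret bounded_pseudo_BCK le impl impr one zero
    by fact
  have "affine_on (SM1 le impl impr zero) Psi"
    by (auto simp: affine_on_def SM1_def state_measure_convex_comb)
      (auto simp: Psi_def convex_comb_def algebra_simps)
  then show ?thesis
    using homeomorphic_map_Psi morphism_iff_Psi extremal_iff_morphism
    by (simp add: SM1_def)
qed

end
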